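(* Let $k$ be a positive integer. Let $P_k\subseteq[0,1]^{\mathcal S_k}$ be the set of vectors $\vec v=(\vec v_\pi)_{\pi\in\mathcal S_k}$ for which there exists a sequence of permutations $(\sigma^m)_{m\in\mathbb N}$ with $|\sigma^m|\to\infty$ and $\widetilde{\mathrm{c\text{-}occ}}(\pi,\sigma^m)\to\vec v_\pi$ for all $\pi\in\mathcal S_k$. Let $\mathcal O_k$ be the overlap graph of order $k$. Then $P_k$ equals the cycle polytope $P(\mathcal O_k)$; its dimension is $k!-(k-1)!$; and its vertices are given by the simple cycles of $\mathcal O_k$, i.e. the vertex set of $P_k$ is $\{\vec e_{\mathcal C} : \mathcal C \text{ a simple cycle of } \mathcal O_k\}$.
   Context: $\mathcal S_n$ denotes the set of permutations of size $n$ (written in one-line notation), and $|\sigma|$ the size of $\sigma$. For $\sigma\in\mathcal S_n$ and $\pi\in\mathcal S_k$, a consecutive occurrence of $\pi$ in $\sigma$ is an interval of indices $i,i+1,\dots,i+k-1$ such that $\sigma(i)\dots\sigma(i+k-1)$ has the same relative order as $\pi$; $\mathrm{c\text{-}occ}(\pi,\sigma)$ is the number of such occurrences and $\widetilde{\mathrm{c\text{-}occ}}(\pi,\sigma)=\mathrm{c\text{-}occ}(\pi,\sigma)/n$. The overlap graph $\mathcal O_k$ is the directed multigraph whose vertex set is $\mathcal S_{k-1}$ and which has, for every $\pi\in\mathcal S_k$, one edge labeled $\pi$ going from the pattern formed by the first $k-1$ entries of $\pi$ to the pattern formed by the last $k-1$ entries of $\pi$; thus its edge set is identified with $\mathcal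 S_k$. For a directed multigraph $G=(V,E)$, a cycle is a closed walk $e_1,\dots,e_n$ of edges ($n\ge1$, the head of $e_i$ is the tail of $e_{i+1}$, indices mod $n$), with length $|\mathcal C|=n$; it is simple if it does not repeat vertices. For a non-empty cycle $\mathcal C$, $\vec e_{\mathcal C}\in\mathbb R^E$ is defined by $(\vec e_{\mathcal C})_e=(\text{number of occurrences of } e \text{ in } \mathcal C)/|\mathcal C|$. The cycle polytope of $G$ is $P(G)=\operatorname{conv}\{\vec e_{\mathcal C}: \mathcal C \text{ a simple cycle of } G\}$. *)

theory Defs
  imports
    "HOL-Analysis.Analysis"
    "HOL-Analysis.Finite_Function_Topology"
    "HOL-Combinatorics.Multiset_Permutations"
    "Graph_Theory.Arc_Walk"
begin

section \<open>Permutations and consecutive patterns\<close>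

text \<open>One-line notation: the permutation \<open>\<sigma>\<close> of size \<open>n\<close> is the list
  \<open>[\<sigma>(1), \<dots>, \<sigma>(n)]\<close>. Entries are numbered from 1, list positions from 0.\<close>

definition perms :: "nat \<Rightarrow> nat list set" where
  "perms n = permutations_of_set {1..n}"

text \<open>The pattern formed by a sequence of distinct numbers: every entry is replaced by its rank.\<close>

definition std :: "nat list \<Rightarrow> nat list" where
  "std xs = map (\<lambda>x. card {y \<in> set xs. y \<le> x}) xs"

definition same_relative_order :: "nat list \<Rightarrow> nat list \<Rightarrow> bool" where
  "same_relative_order xs ys \<longleftrightarrow> length xs = length ys \<and>
     (\<forall>a < length xs. \<forall>b < length xs. xs ! a < xs ! b \<longleftrightarrow> ys ! a < ys ! b)"

definition c_occ :: "nat list \<Rightarrow> nat list \<Rightarrow> nat" where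
  "c_occ \<pi> \<sigma> = card {i. i + length \<pi> \<le> length \<sigma> \<and>
     same_relative_order (take (length \<pi>) (drop i \<sigma>)) \<pi>}"

definition c_occ_freq :: "nat list \<Rightarrow> nat list \<Rightarrow> real" where
  "c_occ_freq \<pi> \<sigma> = real (c_occ \<pi> \<sigma>) / real (length \<sigma>)"

lemma length_perms: "\<sigma> \<in> perms n \<Longrightarrow> length \<sigma> = n"
  by (auto simp: perms_def permutations_of_set_def distinct_card[symmetric])

lemma finite_perms: "finite (perms n)"
  by (simp add: perms_def)

lemma card_perms: "card (perms n) = fact n"
  by (simp add: perms_def)

lemma rank_less_iff:
  fixes x y :: nat
  assumes "finite A" "x \<in> A" "y \<in> A"
  shows "card {z \<in> A. z \<le> x} < card {z \<in> A. z \<le> y} \<longleftrightarrow> x < y"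
proof
  assume "x < y"
  then have "{z \<in> A. z \<le> x} \<subset> {z \<in> A. z \<le> y}"
    using assms by (auto simp: psubset_eq set_eq_iff) (meson leD order_refl)
  then show "card {z \<in> A. z \<le> x} < card {z \<in> A. z \<le> y}"
    using assms by (intro psubset_card_mono) auto
next
  assume *: "card {z \<in> A. z \<le> x} < card {z \<in> A. z \<le> y}"
  show "x < y"
  proof (rule ccontr)
    assume "\<not> x < y"
    then have "card {z \<in> A. z \<le> y} \<le> card {z \<in> A. z \<le> x}"
      using assms by (intro card_mono) auto
    with * show False by simp
  qed
qed

lemma same_relative_order_std: "same_relative_order xs (std xs)"
  by (auto simp: same_relative_order_def std_def rank_less_iff)

lemma std_in_perms:
  assumes "distinct xs"
  shows "std xs \<in> perms (length xs)"
proof -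
  let ?r = "\<lambda>x. card {y \<in> set xs. y \<le> x}"
  have inj: "inj_on ?r (set xs)"
  proof (rule inj_onI)
    fix x y assume "x \<in> set xs" "y \<in> set xs" "?r x = ?r y"
    then show "x = y"
      using rank_less_iff[of "set xs" x y] rank_less_iff[of "set xs" y x] by simp
  qed
  have "?r ` set xs \<subseteq> {1..length xs}"
  proof
    fix m assume "m \<in> ?r ` set xs"
    then obtain x where x: "x \<in> set xs" "m = ?r x" by auto
    have "?r x \<le> card (set xs)" by (intro card_mono) auto
    moreover have "0 < ?r x" using x by (auto simp: card_gt_0_iff)
    ultimately show "m \<in> {1..length xs}"
      using x assms by (auto simp: distinct_card)
  qed
  moreover have "card (?r ` set xs) = card {1..length xs}"
    using assms by (simp add: card_image[OF inj] distinct_card)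
  ultimately have "?r ` set xs = {1..length xs}"
    by (intro card_subset_eq) auto
  then show ?thesis
    using assms inj
    by (auto simp: perms_def permutations_of_set_def std_def distinct_map)
qed

lemma std_eq_if_same_relative_order:
  assumes "same_relative_order xs ys" "ys \<in> perms n"
  shows "std xs = ys"
proof (rule nth_equalityI)
  have ys: "set ys = {1..n}" "distinct ys"
    using assms(2) by (auto simp: perms_def permutations_of_set_def)
  have len: "length xs = length ys"
    using assms(1) by (simp add: same_relative_order_def)
  show "length (std xs) = length ys"
    by (simp add: std_def len)
  have ord: "xs ! a \<le> xs ! b \<longleftrightarrow> ys ! a \<le> ys ! b"
    if "a < length ys" "b < length ys" for a b
    using assms(1) that len by (auto simp: same_relative_order_def not_less[symmetric])
  have "inj_on (\<lambda>a. xs ! a) {..<length ys}"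
  proof (rule inj_onI)
    fix a b assume ab: "a \<in> {..<length ys}" "b \<in> {..<length ys}" "xs ! a = xs ! b"
    then have "ys ! a = ys ! b"
      using ord[of a b] ord[of b a] by auto
    then show "a = b"
      using ab ys(2) by (auto simp: nth_eq_iff_index_eq)
  qed
  note inj = this
  fix i assume "i < length (std xs)"
  then have i: "i < length ys" by (simp add: std_def len)
  let ?I = "{a. a < length ys \<and> ys ! a \<le> ys ! i}"
  have "std xs ! i = card {y \<in> set xs. y \<le> xs ! i}"
    using i len by (simp add: std_def)
  also have "{y \<in> set xs. y \<le> xs ! i} = (\<lambda>a. xs ! a) ` ?I"
    using i ord len by (auto simp: in_set_conv_nth image_iff)
  also have "card \<dots> = card ?I"
    using inj by (intro card_image) (auto intro: inj_on_subset)
  also have "\<dots> = card ((\<lambda>a. ys ! a) ` ?I)"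
    using ys(2) by (intro card_image[symmetric]) (auto simp: inj_on_def nth_eq_iff_index_eq)
  also have "(\<lambda>a. ys ! a) ` ?I = {y \<in> set ys. y \<le> ys ! i}"
    by (auto simp: in_set_conv_nth image_iff)
  also have "\<dots> = {1..ys ! i}"
  proof -
    have "ys ! i \<in> {1..n}" using ys(1) i nth_mem by blast
    then show ?thesis by (auto simp: ys(1))
  qed
  finally show "std xs ! i = ys ! i" by simp
qed

section \<open>Overlap graphs and cycle polytopes\<close>

definition overlap_graph :: "nat \<Rightarrow> (nat list, nat list) pre_digraph" where
  "overlap_graph k =
     \<lparr> verts = perms (k - 1),
       arcs = perms k,
       tail = \<lambda>\<pi>. std (take (k - 1) \<pi>),
       head = \<lambda>\<pi>. std (drop 1 \<pi>) \<rparr>"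

lemma wf_overlap_graph:
  assumes "0 < k"
  shows "wf_digraph (overlap_graph k)"
proof
  fix \<pi> assume "\<pi> \<in> arcs (overlap_graph k)"
  then have *: "distinct \<pi>" "length \<pi> = k"
    using length_perms by (auto simp: overlap_graph_def perms_def permutations_of_set_def)
  show "tail (overlap_graph k) \<pi> \<in> verts (overlap_graph k)"
    using * assms std_in_perms[of "take (k - 1) \<pi>"] by (simp add: overlap_graph_def)
  show "head (overlap_graph k) \<pi> \<in> verts (overlap_graph k)"
    using * assms std_in_perms[of "drop 1 \<pi>"] by (simp add: overlap_graph_def)
qed

text \<open>
  For a finite set \<open>E\<close>, the space of real vectors indexed by \<open>E\<close> is rendered as the subspace of
  those finitely supported functions \<open>'e \<Rightarrow>\<^sub>0 real\<close> whose support (\<^const>\<open>Poly_Mapping.keys\<close>) lies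
  in \<open>E\<close>; the component at \<open>e\<close> is \<open>lookup v e\<close>.
\<close>

lift_definition cycle_vec :: "'e list \<Rightarrow> ('e \<Rightarrow>\<^sub>0 real)" is
  "\<lambda>C e. real (count_list C e) / real (length C)"
proof -
  fix C :: "'e list"
  have "{e. real (count_list C e) / real (length C) \<noteq> 0} \<subseteq> set C"
    by (auto intro: ccontr simp: count_notin)
  then show "finite {e. real (count_list C e) / real (length C) \<noteq> 0}"
    using finite_subset by blast
qed

text \<open>\<^const>\<open>pre_digraph.cycle\<close> is the notion of a simple cycle: a non-empty closed walk (a list of
  arcs, loops allowed) that does not repeat vertices.\<close>

definition cycle_polytope :: "('v, 'e) pre_digraph \<Rightarrow> ('e \<Rightarrow>\<^sub>0 real) set" where
  "cycle_polytope G = convex hull {cycle_vec C | C. pre_digraph.cycle G C}"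

section \<open>The feasible region\<close>

definition feasible_region :: "nat \<Rightarrow> (nat list \<Rightarrow>\<^sub>0 real) set" where
  "feasible_region k =
     {v. Poly_Mapping.keys v \<subseteq> perms k \<and>
         (\<forall>\<pi> \<in> perms k. 0 \<le> Poly_Mapping.lookup v \<pi> \<and> Poly_Mapping.lookup v \<pi> \<le> 1) \<and>
         (\<exists>\<sigma> :: nat \<Rightarrow> nat list.
            (\<forall>m. \<sigma> m \<in> perms (length (\<sigma> m))) \<and>
            filterlim (\<lambda>m. length (\<sigma> m)) at_top sequentially \<and>
            (\<forall>\<pi> \<in> perms k. (\<lambda>m. c_occ_freq \<pi> (\<sigma> m)) \<longlonglongrightarrow> Poly_Mapping.lookup v \<pi>))}"

section \<open>Dimension\<close>

text \<open>The dimension of the affine hull of a non-empty set, i.e. of the linear span of its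
  differences. The library's \<^const>\<open>aff_dim\<close>, with which it agrees, is restricted to Euclidean
  spaces.\<close>

definition affine_dimension :: "'a::real_vector set \<Rightarrow> nat" where
  "affine_dimension S = dim {x - y | x y. x \<in> S \<and> y \<in> S}"

lemma aff_dim_eq_affine_dimension:
  fixes S :: "'a::euclidean_space set"
  assumes "S \<noteq> {}"
  shows "aff_dim S = int (affine_dimension S)"
proof -
  obtain a where a: "a \<in> S" using assms by auto
  let ?T = "(\<lambda>x. - a + x) ` S" and ?D = "{x - y | x y. x \<in> S \<and> y \<in> S}"
  have T_D: "?T \<subseteq> ?D"
  proof
    fix d assume "d \<in> ?T"
    then obtain x where "x \<in> S" "d = x - a" by auto
    with a show "d \<in> ?D" by blast
  qed
  have D_T: "?D \<subseteq> span ?T"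
  proof
    fix d assume "d \<in> ?D"
    then obtain x y where xy: "x \<in> S" "y \<in> S" "d = x - y" by blast
    then have d: "d = (- a + x) - (- a + y)" by simp
    then show "d \<in> span ?T"
      unfolding d by (intro span_diff span_base imageI xy)
  qed
  have "dim ?T = dim ?D"
    using dim_subset[OF T_D] dim_subset[OF D_T] unfolding dim_span by (rule order_antisym)
  moreover have "aff_dim S = int (dim ?T)"
    using a by (intro aff_dim_eq_dim) (simp add: hull_inc)
  ultimately show ?thesis
    by (simp add: affine_dimension_def)
qed

end

(* The region is the polytope of non-negative unit flows on the overlap graph: the window
   patterns of a long permutation form a walk, whose arc counts are balanced up to one unit per
   vertex, and conversely every walk is realised by a permutation because a new last entry can be
   inserted anywhere relative to the preceding ones. Peeling cycles off the support of a flow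
   writes it as a convex combination of simple cycles; a flow carried by a single simple cycle is
   constant along it, so simple cycles are extreme. Strong connectivity turns a convex combination
   of cycles into one long closed walk with nearly prescribed frequencies. It also gives a strictly
   positive flow, so that the affine hull is cut out by the total and by the balance equations,
   of which all but one are independent. *)

theory Submission
  imports Defs "Graph_Theory.Digraph_Component"
begin

section \<open>Flows on finite digraphs\<close>

lemma lookup_scaleR [simp]:
  "Poly_Mapping.lookup (c *\<^sub>R v) e = c *\<^sub>R Poly_Mapping.lookup v e"
proof -
  have "finite {i. c *\<^sub>R Poly_Mapping.lookup v i \<noteq> 0}"
    by (rule finite_subset[OF _ finite_keys[of v]]) (auto simp: in_keys_iff)
  then show ?thesis
    by (simp add: scaleR_poly_mapping_def Abs_poly_mapping_inverse)
qed

text \<open>Unnormalised arc counts. Rescaling \<open>cycle_vec\<close> makes the finiteness of the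
  support automatic; the empty list gives 0 because the scalar is 0.\<close>

definition arc_vec :: "'e list \<Rightarrow> ('e \<Rightarrow>\<^sub>0 real)" where
  "arc_vec p = real (length p) *\<^sub>R cycle_vec p"

lemma lookup_arc_vec [simp]: "Poly_Mapping.lookup (arc_vec p) e = real (count_list p e)"
  by (cases "p = []") (auto simp: arc_vec_def cycle_vec.rep_eq)

lemma cycle_vec_conv_arc_vec: "cycle_vec p = (1 / real (length p)) *\<^sub>R arc_vec p"
  by (rule poly_mapping_eqI) (simp add: cycle_vec.rep_eq)

lemma keys_arc_vec [simp]: "Poly_Mapping.keys (arc_vec p) = set p"
  by (auto simp: in_keys_iff count_list_0_iff)

lemma keys_cycle_vec: "Poly_Mapping.keys (cycle_vec p) \<subseteq> set p"
  by (auto simp: in_keys_iff cycle_vec.rep_eq count_list_0_iff)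

context pre_digraph
begin

definition netflow :: "('b \<Rightarrow>\<^sub>0 real) \<Rightarrow> 'a \<Rightarrow> real" where
  "netflow v w = (\<Sum>e\<in>out_arcs G w. Poly_Mapping.lookup v e) - (\<Sum>e\<in>in_arcs G w. Poly_Mapping.lookup v e)"

definition total :: "('b \<Rightarrow>\<^sub>0 real) \<Rightarrow> real" where
  "total v = (\<Sum>e\<in>arcs G. Poly_Mapping.lookup v e)"

text \<open>These are the circulations of total mass 1.\<close>

definition flow_polytope :: "('b \<Rightarrow>\<^sub>0 real) set" where
  "flow_polytope = {v. Poly_Mapping.keys v \<subseteq> arcs G \<and> (\<forall>e. 0 \<le> Poly_Mapping.lookup v e) \<and>
     total v = 1 \<and> (\<forall>w\<in>verts G. netflow v w = 0)}"

lemma linear_total: "linear total"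
  by (rule linearI) (simp_all add: total_def lookup_add sum.distrib sum_distrib_left)

lemma linear_netflow: "linear (\<lambda>v. netflow v w)"
  by (rule linearI) (simp_all add: netflow_def lookup_add sum.distrib sum_distrib_left algebra_simps)

lemmas total_simps [simp] =
  linear_add[OF linear_total] linear_diff[OF linear_total] linear_scale[OF linear_total]
  linear_0[OF linear_total]

lemmas netflow_simps [simp] =
  linear_add[OF linear_netflow] linear_diff[OF linear_netflow] linear_scale[OF linear_netflow]
  linear_0[OF linear_netflow]

lemma convex_flow_polytope: "convex flow_polytope"
  unfolding convex_alt flow_polytope_def
  by (auto simp: in_keys_iff lookup_add subset_iff) (metis add.right_neutral mult_zero_right)

end

context fin_digraph
begin

lemma total_arc_vec:
  assumes "set p \<subseteq> arcs G"
  shows "total (arc_vec p) = real (length p)"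
proof -
  have "(\<Sum>e\<in>arcs G. count_list p e) = length p"
    using sum_count_set[of p "arcs G"] assms by simp
  then show ?thesis
    by (simp add: total_def flip: of_nat_sum)
qed

text \<open>Telescoping: an arc contributes 1 at its tail and -1 at its head, which is the tail of
  the next arc, so only the two endpoints survive.\<close>

lemma netflow_arc_vec:
  assumes "awalk u p v"
  shows "netflow (arc_vec p) w = of_bool (w = u) - of_bool (w = v)"
  using assms
proof (induction p arbitrary: u)
  case Nil
  then show ?case by (simp add: awalk_Nil_iff netflow_def)
next
  case (Cons e p)
  then have e: "e \<in> arcs G" "u = tail G e" and p: "awalk (head G e) p v"
    by (auto simp: awalk_Cons_iff)
  have *: "Poly_Mapping.lookup (arc_vec (e # p)) f =
      of_bool (f = e) + Poly_Mapping.lookup (arc_vec p) f" for f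
    by auto
  have "netflow (arc_vec (e # p)) w =
     of_bool (w = tail G e) - of_bool (w = head G e) + netflow (arc_vec p) w"
    unfolding netflow_def * using e
    by (auto simp: sum.distrib of_bool_def sum.delta finite_in_arcs finite_out_arcs
        simp del: lookup_arc_vec)
  then show ?case
    using Cons.IH[OF p] e by simp
qed

text \<open>The endpoints coincide, so their contributions cancel. Closed walks that repeat vertices
  are included; they supply the strictly positive flow later.\<close>

lemma cycle_vec_in_flow_polytope:
  assumes "closed_w p"
  shows "cycle_vec p \<in> flow_polytope"
proof -
  from assms obtain u where p: "awalk u p u" "p \<noteq> []"
    by (auto simp: closed_w_def)
  then have sub: "set p \<subseteq> arcs G" by auto
  have "total (cycle_vec p) = 1" "netflow (cycle_vec p) w = 0" for w
    using p total_arc_vec[OF sub] netflow_arc_vec[OF p(1)]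
    by (simp_all add: cycle_vec_conv_arc_vec)
  then show ?thesis
    using keys_cycle_vec[of p] sub by (auto simp: flow_polytope_def cycle_vec.rep_eq)
qed

lemma cycle_imp_closed_w: "cycle p \<Longrightarrow> closed_w p"
  by (auto simp: cycle_def closed_w_def)

lemma cycle_polytope_subset_flow_polytope: "cycle_polytope G \<subseteq> flow_polytope"
  unfolding cycle_polytope_def
  by (rule hull_minimal)
     (auto simp: convex_flow_polytope intro: cycle_vec_in_flow_polytope cycle_imp_closed_w)

section \<open>Decomposition of flows into simple cycles\<close>

text \<open>By \<open>out\<close> every walk inside \<open>S\<close> can be prolonged. With more
  arcs than there are vertices it must revisit a vertex, and the closed walk found there contains a
  simple cycle.\<close>

lemma ex_cycle_in_support:
  assumes S: "S \<subseteq> arcs G" "S \<noteq> {}"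
    and out: "\<And>e. e \<in> S \<Longrightarrow> \<exists>f\<in>S. tail G f = head G e"
  shows "\<exists>C. cycle C \<and> set C \<subseteq> S"
proof -
  \<comment> \<open>All vertices are kept, so walks of \<open>H\<close> are the walks of
    \<open>G\<close> that use only arcs of \<open>S\<close>.\<close>
  define H where "H = \<lparr>verts = verts G, arcs = S, tail = tail G, head = head G\<rparr>"
  interpret H: fin_digraph H
    using S by unfold_locales (auto simp: H_def intro: finite_subset)
  have "subgraph H G"
    using S by (auto simp: subgraph_def H_def compatible_def H.wf_digraph wf_digraph
        intro: H.wf_digraph[unfolded H_def])
  have long: "\<exists>u p v. H.awalk u p v \<and> length p = Suc n" for n
  proof (induction n)
    case 0
    from S obtain e where "e \<in> S" by blast
    then have "H.awalk (tail G e) [e] (head G e)"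
      using H.arc_implies_awalk[of e] by (simp add: H_def)
    then show ?case by force
  next
    case (Suc n)
    then obtain u p v where p: "H.awalk u p v" "length p = Suc n" by blast
    then have last: "last p \<in> S" "head G (last p) = v"
      using H.awalk_verts_conv[of u p] H.awlast_of_awalk[OF p(1)]
      by (cases p rule: rev_cases; auto simp: H_def H.awalk_def pre_digraph.awalk_def)+
    then obtain f where f: "f \<in> S" "tail G f = v" using out by blast
    then have "H.awalk v [f] (head G f)"
      using H.arc_implies_awalk[of f] by (simp add: H_def)
    from H.awalk_appendI[OF p(1) this] p(2) show ?case
      by (intro exI[of _ u] exI[of _ "p @ [f]"] exI[of _ "head G f"]) simp
  qed
  from long[of "card (verts H)"] obtain u p v
    where p: "H.awalk u p v" "length p = Suc (card (verts H))" by blast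
  have "\<not> H.apath u p v" using H.length_apath[of u p v] p by auto
  then have "\<not> distinct (H.awalk_verts u p)" using p by (simp add: H.apath_def)
  from H.awalk_not_distinct_decomp[OF p(1) this] obtain r where "H.closed_w r"
    by (auto simp: H.closed_w_def)
  then obtain C where C: "H.cycle C" using H.closed_w_imp_cycle by blast
  have "arcs H = S" by (simp add: H_def)
  then have "set C \<subseteq> S" using C by (auto simp: H.cycle_def H.awalk_def)
  moreover have "cycle C" using subgraph_cycle[OF \<open>subgraph H G\<close> C] .
  ultimately show ?thesis by blast
qed

text \<open>No vertex repeats, hence no arc does; subtracting \<open>m *\<^sub>R arc_vec C\<close>
  therefore lowers each arc of \<open>C\<close> by exactly \<open>m\<close>.\<close>

lemma cycle_count_list:
  assumes "cycle C"
  shows "count_list C e = of_bool (e \<in> set C)"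
proof -
  have "distinct C" using assms cycle_conv by blast
  then show ?thesis by (induction C) auto
qed

text \<open>Subtracting the largest possible multiple of a cycle inside the support kills at least one arc.\<close>

lemma flow_in_cycle_polytope:
  assumes "Poly_Mapping.keys v \<subseteq> arcs G" "\<And>e. 0 \<le> Poly_Mapping.lookup v e"
    "\<And>w. w \<in> verts G \<Longrightarrow> netflow v w = 0" "v \<noteq> 0"
  shows "0 < total v \<and> (1 / total v) *\<^sub>R v \<in> cycle_polytope G"
  using assms
\<comment> \<open>The total is left free because the remainder after a subtraction has smaller mass;
  only the conclusion rescales.\<close>
proof (induction "card (Poly_Mapping.keys v)" arbitrary: v rule: less_induct)
  case less
  note sub = less.prems(1) and nonneg = less.prems(2) and bal = less.prems(3)
  let ?S = "Poly_Mapping.keys v"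
  \<comment> \<open>Conservation: the positive amount that \<open>e\<close> brings into its head
    must leave along some arc of the support.\<close>
  have out: "\<exists>f\<in>?S. tail G f = head G e" if e: "e \<in> ?S" for e
  proof -
    have eG: "e \<in> arcs G" using e sub by blast
    have "0 < Poly_Mapping.lookup v e"
      using nonneg[of e] e by (auto simp: in_keys_iff)
    also have "\<dots> \<le> (\<Sum>f\<in>in_arcs G (head G e). Poly_Mapping.lookup v f)"
      by (rule member_le_sum) (use nonneg eG in auto)
    also have "\<dots> = (\<Sum>f\<in>out_arcs G (head G e). Poly_Mapping.lookup v f)"
      using bal[of "head G e"] eG by (simp add: netflow_def)
    finally obtain f where "f \<in> out_arcs G (head G e)" "Poly_Mapping.lookup v f \<noteq> 0"
      by (metis less_irrefl sum.neutral)
    then show ?thesis by (auto simp: in_keys_iff)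
  qed
  obtain C where C: "cycle C" "set C \<subseteq> ?S"
    using ex_cycle_in_support[of ?S] sub out less.prems(4) by auto
  then have "C \<noteq> []" by (auto simp: cycle_def)
  have CP: "cycle_vec C \<in> cycle_polytope G"
    unfolding cycle_polytope_def using C by (intro hull_inc) blast
  have Cf: "cycle_vec C \<in> flow_polytope"
    using cycle_vec_in_flow_polytope cycle_imp_closed_w C by blast
  define m where "m = Min (Poly_Mapping.lookup v ` set C)"
  define v' where "v' = v - m *\<^sub>R arc_vec C"
  have m_in: "m \<in> Poly_Mapping.lookup v ` set C"
    unfolding m_def using \<open>C \<noteq> []\<close> by (intro Min_in) auto
  then obtain e0 where e0: "e0 \<in> set C" "Poly_Mapping.lookup v e0 = m" by auto
  have m_le: "m \<le> Poly_Mapping.lookup v e" if "e \<in> set C" for e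
    unfolding m_def using that by (intro Min_le) auto
  have "0 < m"
    using e0 C nonneg[of e0] by (auto simp: in_keys_iff subset_iff)
  have lv': "Poly_Mapping.lookup v' e = Poly_Mapping.lookup v e - m * of_bool (e \<in> set C)" for e
    by (simp add: v'_def lookup_minus cycle_count_list[OF C(1)])
  have keys': "Poly_Mapping.keys v' \<subseteq> ?S" "e0 \<notin> Poly_Mapping.keys v'"
    using C(2) e0 by (auto simp: in_keys_iff lv' of_bool_def subset_iff split: if_splits)
  have "e0 \<in> ?S" using e0 C by blast
  with keys' have card': "card (Poly_Mapping.keys v') < card ?S"
    by (intro psubset_card_mono) auto
  have nonneg': "0 \<le> Poly_Mapping.lookup v' e" for e
    using m_le[of e] nonneg[of e] by (auto simp: lv' of_bool_def)
  have arcv: "arc_vec C = real (length C) *\<^sub>R cycle_vec C" by (simp add: arc_vec_def)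
  have bal': "netflow v' w = 0" if "w \<in> verts G" for w
    using bal[OF that] Cf that by (simp add: v'_def arcv flow_polytope_def)
  define c where "c = m * real (length C)"
  have "0 < c" using \<open>0 < m\<close> \<open>C \<noteq> []\<close> by (simp add: c_def)
  have v_eq: "v = v' + c *\<^sub>R cycle_vec C" by (simp add: v'_def arcv c_def)
  then have tot: "total v = total v' + c"
    using Cf by (simp add: flow_polytope_def)
  show ?case
  proof (cases "v' = 0")
    case True
    then show ?thesis using tot v_eq \<open>0 < c\<close> CP by simp
  next
    case False
    then have IH: "0 < total v'" "(1 / total v') *\<^sub>R v' \<in> cycle_polytope G"
      using less.hyps[OF card'] keys' sub nonneg' bal' by auto
    \<comment> \<open>A convex combination whose weights are the shares of the total held by the
      remainder and by the cycle.\<close>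
    have "(1 / total v) *\<^sub>R v =
       (total v' / total v) *\<^sub>R ((1 / total v') *\<^sub>R v') + (c / total v) *\<^sub>R cycle_vec C"
      using IH(1) by (subst v_eq) (simp add: scaleR_add_right)
    also have "\<dots> \<in> cycle_polytope G"
    proof (rule convexD)
      show "convex (cycle_polytope G)" by (simp add: cycle_polytope_def)
      show "total v' / total v + c / total v = 1"
        using tot IH(1) \<open>0 < c\<close> by (simp flip: add_divide_distrib)
    qed (use IH CP tot \<open>0 < c\<close> in auto)
    finally show ?thesis using tot IH(1) \<open>0 < c\<close> by simp
  qed
qed

lemma flow_polytope_eq_cycle_polytope: "flow_polytope = cycle_polytope G"
proof (rule antisym[OF subsetI cycle_polytope_subset_flow_polytope])
  fix v assume v: "v \<in> flow_polytope"
  then have "v \<noteq> 0" by (auto simp: flow_polytope_def)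
  with flow_in_cycle_polytope[of v] v show "v \<in> cycle_polytope G"
    by (auto simp: flow_polytope_def)
qed

section \<open>Extreme points of the flow polytope\<close>

text \<open>Each vertex of \<open>C\<close> has one entering and one leaving arc in
  \<open>C\<close>, so balance forces equal values on consecutive arcs, and the total 1 fixes the
  common value.\<close>

lemma flow_on_cycle_unique:
  assumes C: "cycle C" and v: "v \<in> flow_polytope" and sub: "Poly_Mapping.keys v \<subseteq> set C"
  shows "v = cycle_vec C"
proof -
  obtain u where u: "awalk u C u" "distinct (tl (awalk_verts u C))" "C \<noteq> []"
    using C by (auto simp: cycle_def)
  have cas: "cas u C u" and CG: "set C \<subseteq> arcs G" using u by auto
  have vs: "awalk_verts u C = u # map (head G) C"
    using awalk_verts_conv'[OF cas] u(3) cas_simp[OF u(3)] cas by simp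
  have vs2: "awalk_verts u C = map (tail G) C @ [u]"
    using awalk_verts_conv[of u C] u(3) awlast_of_awalk[OF u(1)] by (metis (no_types, lifting) awlast_if_cas cas last_snoc)
  have dh: "distinct (map (head G) C)" using u(2) vs by simp
  \<comment> \<open>The vertex list is \<open>u\<close> followed by the heads, and also the tails
    followed by \<open>u\<close>. Cancelling \<open>u\<close> shows that heads and tails form the
    same multiset.\<close>
  have dt: "distinct (map (tail G) C)"
  proof -
    have "mset (map (tail G) C) = mset (map (head G) C)"
      using arg_cong[OF trans[OF vs[symmetric] vs2], of mset] by simp
    then show ?thesis using dh mset_eq_imp_distinct_iff by blast
  qed
  have zero: "Poly_Mapping.lookup v e = 0" if "e \<notin> set C" for e
    using sub that by (auto simp: in_keys_iff)
  have step: "Poly_Mapping.lookup v (C ! Suc i) = Poly_Mapping.lookup v (C ! i)"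
    if i: "Suc i < length C" for i
  proof -
    let ?w = "head G (C ! i)"
    have w: "tail G (C ! Suc i) = ?w"
    proof -
      have "awalk_verts u C ! Suc i = map (tail G) C ! Suc i" using i by (simp add: vs2 nth_append)
      moreover have "awalk_verts u C ! Suc i = ?w" using i by (simp add: vs)
      ultimately show ?thesis using i by simp
    qed
    have Ci: "C ! i \<in> arcs G" "C ! Suc i \<in> arcs G"
      using CG i by (auto simp: subset_iff)
    have o: "e = C ! Suc i" if "e \<in> set C" "tail G e = ?w" for e
      using dt that w i by (metis distinct_map inj_onD nth_mem)
    have h: "e = C ! i" if "e \<in> set C" "head G e = ?w" for e
      using dh that i by (metis Suc_lessD distinct_map inj_onD nth_mem)
    have o': "Poly_Mapping.lookup v e = 0" if "tail G e = ?w" "e \<noteq> C ! Suc i" for e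
      using zero o that by blast
    have h': "Poly_Mapping.lookup v e = 0" if "head G e = ?w" "e \<noteq> C ! i" for e
      using zero h that by blast
    \<comment> \<open>One arc of \<open>C\<close> leaves \<open>?w\<close> and one enters it; all
      others carry 0, so both sums reduce to single terms.\<close>
    have "(\<Sum>e\<in>out_arcs G ?w. Poly_Mapping.lookup v e) = (\<Sum>e\<in>{C ! Suc i}. Poly_Mapping.lookup v e)"
      by (rule sum.mono_neutral_right) (use Ci w o' in auto)
    moreover have "(\<Sum>e\<in>in_arcs G ?w. Poly_Mapping.lookup v e) = (\<Sum>e\<in>{C ! i}. Poly_Mapping.lookup v e)"
      by (rule sum.mono_neutral_right) (use Ci h' in auto)
    moreover have "netflow v ?w = 0" using v Ci by (simp add: flow_polytope_def)
    ultimately show ?thesis by (simp add: netflow_def)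
  qed
  have const: "Poly_Mapping.lookup v (C ! i) = Poly_Mapping.lookup v (C ! 0)" if "i < length C" for i
    using that by (induction i) (auto simp: step)
  then have const': "Poly_Mapping.lookup v e = Poly_Mapping.lookup v (C ! 0)" if "e \<in> set C" for e
    using that by (auto simp: in_set_conv_nth)
  have "distinct C" using dh by (simp add: distinct_map)
  have "1 = total v" using v by (simp add: flow_polytope_def)
  also have "total v = (\<Sum>e\<in>set C. Poly_Mapping.lookup v e)"
    unfolding total_def by (rule sum.mono_neutral_right) (use CG zero in auto)
  also have "\<dots> = (\<Sum>e\<in>set C. Poly_Mapping.lookup v (C ! 0))"
    by (rule sum.cong) (auto intro: const')
  also have "\<dots> = real (length C) * Poly_Mapping.lookup v (C ! 0)"
    using \<open>distinct C\<close> by (simp add: distinct_card)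
  finally have val: "Poly_Mapping.lookup v (C ! 0) = 1 / real (length C)"
    using u(3) by (simp add: field_simps)
  show ?thesis
  proof (rule poly_mapping_eqI)
    fix e
    show "Poly_Mapping.lookup v e = Poly_Mapping.lookup (cycle_vec C) e"
      using const'[of e] zero[of e] val
      by (auto simp: cycle_vec.rep_eq cycle_count_list[OF C] of_bool_def)
  qed
qed

text \<open>Extreme points of a convex hull are among its generators. Conversely, the ends of a
  segment through \<open>cycle_vec C\<close> are nonnegative, hence vanish off \<open>C\<close>, and
  uniqueness identifies both with \<open>cycle_vec C\<close>.\<close>

lemma extreme_point_flow_polytope:
  "{v. v extreme_point_of flow_polytope} = {cycle_vec C | C. cycle C}"
proof (rule antisym)
  show "{v. v extreme_point_of flow_polytope} \<subseteq> {cycle_vec C | C. cycle C}"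
    unfolding flow_polytope_eq_cycle_polytope cycle_polytope_def
    by (rule extreme_points_of_convex_hull)
  have "cycle_vec C extreme_point_of flow_polytope" if C: "cycle C" for C
    unfolding extreme_point_of_def
  proof (intro conjI ballI notI)
    show "cycle_vec C \<in> flow_polytope"
      using C cycle_vec_in_flow_polytope cycle_imp_closed_w by blast
    fix x y assume xy: "x \<in> flow_polytope" "y \<in> flow_polytope" "cycle_vec C \<in> open_segment x y"
    then obtain t where t: "0 < t" "t < 1" "cycle_vec C = (1 - t) *\<^sub>R x + t *\<^sub>R y" "x \<noteq> y"
      by (auto simp: in_segment)
    have "x = cycle_vec C \<and> y = cycle_vec C"
    proof (intro conjI flow_on_cycle_unique C xy)
      have "Poly_Mapping.lookup x e = 0 \<and> Poly_Mapping.lookup y e = 0" if "e \<notin> set C" for e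
      proof -
        have "0 = (1 - t) * Poly_Mapping.lookup x e + t * Poly_Mapping.lookup y e"
          using arg_cong[OF t(3), of "\<lambda>v. Poly_Mapping.lookup v e"] that
          by (simp add: cycle_vec.rep_eq lookup_add)
        moreover have "0 \<le> (1 - t) * Poly_Mapping.lookup x e" "0 \<le> t * Poly_Mapping.lookup y e"
          using xy t by (auto simp: flow_polytope_def)
        ultimately show ?thesis using t
          by (smt (verit) mult_eq_0_iff)
      qed
      then show "Poly_Mapping.keys x \<subseteq> set C" "Poly_Mapping.keys y \<subseteq> set C"
        by (auto simp: in_keys_iff)
    qed
    with t show False by simp
  qed
  then show "{cycle_vec C | C. cycle C} \<subseteq> {v. v extreme_point_of flow_polytope}" by blast
qed

end

section \<open>Dimension of the flow polytope\<close>

text \<open>A basis of the common kernel together with the dual vectors \<open>w u\<close> is a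
  basis of \<open>span A\<close>. Working inside \<open>span A\<close> allows an ambient space of
  infinite dimension.\<close>

lemma dim_common_kernel:
  fixes A :: "'a::real_vector set" and f :: "'u \<Rightarrow> 'a \<Rightarrow> real"
  assumes A: "finite A" "independent A" and V: "finite V"
    and lin: "\<And>u. u \<in> V \<Longrightarrow> linear (f u)"
    and w: "\<And>u. u \<in> V \<Longrightarrow> w u \<in> span A"
    and dual: "\<And>u u'. u \<in> V \<Longrightarrow> u' \<in> V \<Longrightarrow> f u (w u') = of_bool (u = u')"
  shows "dim {x \<in> span A. \<forall>u\<in>V. f u x = 0} + card V = card A"
proof -
  let ?K = "{x \<in> span A. \<forall>u\<in>V. f u x = 0}"
  obtain B where B: "B \<subseteq> ?K" "independent B" "?K \<subseteq> span B" "card B = dim ?K"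
    by (rule basis_exists)
  have finB: "finite B"
    using independent_span_bound[of A B] A B by blast
  have ind: "independent (B \<union> w ` U) \<and> card (B \<union> w ` U) = card B + card U" if "U \<subseteq> V" for U
    using finite_subset[OF that V] that
  proof (induction U rule: finite_induct)
    case empty
    then show ?case using B by simp
  next
    case (insert u U)
    \<comment> \<open>\<open>f u\<close> vanishes on the kernel basis and on the dual vectors
      adjoined so far, yet equals 1 at \<open>w u\<close>.\<close>
    have notin: "w u \<notin> span (B \<union> w ` U)"
    proof
      assume "w u \<in> span (B \<union> w ` U)"
      moreover have "f u x = 0" if "x \<in> B \<union> w ` U" for x
        using that B(1) dual insert by auto
      ultimately have "f u (w u) = 0"
        using linear_eq_0_on_span[of "f u" "B \<union> w ` U" "w u"] lin[of u] insert.prems by simp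
      with dual[of u u] insert.prems show False by simp
    qed
    then have new: "w u \<notin> B \<union> w ` U" using span_base[of "w u"] by metis
    have eq: "B \<union> w ` insert u U = insert (w u) (B \<union> w ` U)" by auto
    have "independent (B \<union> w ` U)" "card (B \<union> w ` U) = card B + card U"
      using insert by auto
    moreover have "finite (B \<union> w ` U)" using finB insert by simp
    ultimately show ?case
      unfolding eq using independent_insertI[OF notin] new insert(2) card_insert_disjoint insert(1)
      by simp
  qed
  have sub: "span A \<subseteq> span (B \<union> w ` V)"
  proof
    fix x assume x: "x \<in> span A"
    \<comment> \<open>The component of \<open>x\<close> along the dual vectors; what remains lies in
      the kernel.\<close>
    define y where "y = (\<Sum>u\<in>V. f u x *\<^sub>R w u)"
    have yA: "y \<in> span A" unfolding y_def by (intro span_sum span_scale w)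
    have "f u (x - y) = 0" if u: "u \<in> V" for u
    proof -
      have "f u y = (\<Sum>u'\<in>V. f u x * of_bool (u = u'))"
        unfolding y_def using u dual
        by (auto simp: linear_sum[OF lin[OF u]] linear_scale[OF lin[OF u]] intro!: sum.cong)
      also have "\<dots> = f u x" using u V by (simp add: of_bool_def if_distrib sum.delta cong: if_cong)
      finally show ?thesis by (simp add: linear_diff[OF lin[OF u]])
    qed
    then have "x - y \<in> span B" using B(3) x yA by (auto intro: span_diff)
    then have "x - y \<in> span (B \<union> w ` V)" using span_mono[of B "B \<union> w ` V"] by blast
    moreover have "y \<in> span (B \<union> w ` V)"
      unfolding y_def by (intro span_sum span_scale span_base) auto
    ultimately show "x \<in> span (B \<union> w ` V)"
      using span_add[of "x - y" _ y] by simp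
  qed
  have "B \<union> w ` V \<subseteq> span A" using B(1) w by auto
  then have "span (B \<union> w ` V) = span A"
    using sub span_minimal subspace_span by blast
  then have "card (B \<union> w ` V) = card A"
    using dim_eq_card[of "B \<union> w ` V" A] ind[OF order_refl] dim_eq_card_independent[OF A(2)] by auto
  then show ?thesis using ind[OF order_refl] B(4) by simp
qed

section \<open>Coordinate vectors and their span\<close>

lemma independent_singles:
  assumes "finite E"
  shows "independent ((\<lambda>e. Poly_Mapping.single e (1::real)) ` E)"
  using assms
proof (induction E rule: finite_induct)
  case empty
  then show ?case by (simp add: independent_empty)
next
  case (insert e E)
  have lin: "linear (\<lambda>v::_ \<Rightarrow>\<^sub>0 real. Poly_Mapping.lookup v e)"
    by (rule linearI) (simp_all add: lookup_add)
  have "Poly_Mapping.single e (1::real) \<notin> span ((\<lambda>e. Poly_Mapping.single e 1) ` E)"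
  proof
    assume "Poly_Mapping.single e (1::real) \<in> span ((\<lambda>e. Poly_Mapping.single e 1) ` E)"
    then have "Poly_Mapping.lookup (Poly_Mapping.single e (1::real)) e = 0"
      by (rule linear_eq_0_on_span[OF lin, rotated]) (use insert in \<open>auto simp: lookup_single when_def\<close>)
    then show False by simp
  qed
  then show ?case using insert independent_insertI by simp
qed

lemma card_singles: "card ((\<lambda>e. Poly_Mapping.single e (1::real)) ` E) = card E"
  by (rule card_image) (auto simp: inj_on_def dest: arg_cong[of _ _ Poly_Mapping.keys])

lemma span_singles:
  assumes "finite E"
  shows "span ((\<lambda>e. Poly_Mapping.single e (1::real)) ` E) = {v. Poly_Mapping.keys v \<subseteq> E}"
proof (rule antisym[OF span_minimal subsetI])
  show "subspace {v::_ \<Rightarrow>\<^sub>0 real. Poly_Mapping.keys v \<subseteq> E}"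
    unfolding subspace_def subset_iff in_keys_iff mem_Collect_eq
    by (simp add: lookup_add) (metis add.right_neutral)
  fix v :: "_ \<Rightarrow>\<^sub>0 real" assume "v \<in> {v. Poly_Mapping.keys v \<subseteq> E}"
  then have "v = (\<Sum>e\<in>E. Poly_Mapping.lookup v e *\<^sub>R Poly_Mapping.single e 1)"
    using assms
    by (intro poly_mapping_eqI)
      (auto simp: lookup_sum lookup_single when_def if_distrib sum.delta in_keys_iff cong: if_cong)
  also have "\<dots> \<in> span ((\<lambda>e. Poly_Mapping.single e (1::real)) ` E)"
    by (intro span_sum span_scale span_base) auto
  finally show "v \<in> span ((\<lambda>e. Poly_Mapping.single e (1::real)) ` E)" .
qed auto

section \<open>Affine hull of the flow polytope of a strongly connected digraph\<close>

context fin_digraph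
begin

text \<open>Every arc is counted once at its tail and once, negatively, at its head. Hence one
  balance equation follows from the others.\<close>

lemma sum_netflow: "(\<Sum>w\<in>verts G. netflow v w) = 0"
proof -
  have "(\<Sum>w\<in>verts G. \<Sum>e\<in>out_arcs G w. Poly_Mapping.lookup v e) = (\<Sum>e\<in>arcs G. Poly_Mapping.lookup v e)"
    unfolding out_arcs_def by (rule sum.group) auto
  moreover have "(\<Sum>w\<in>verts G. \<Sum>e\<in>in_arcs G w. Poly_Mapping.lookup v e) = (\<Sum>e\<in>arcs G. Poly_Mapping.lookup v e)"
    unfolding in_arcs_def by (rule sum.group) auto
  ultimately show ?thesis by (simp add: netflow_def sum_subtractf)
qed

lemma strongly_connected_awalk:
  assumes "strongly_connected G" "u \<in> verts G" "v \<in> verts G"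
  shows "\<exists>p. awalk u p v"
  using assms by (simp add: strongly_connected_def reachable_awalk)

lemma ex_closed_walk_through:
  assumes "strongly_connected G" "e \<in> arcs G"
  shows "\<exists>c. closed_w c \<and> e \<in> set c"
proof -
  obtain p where "awalk (head G e) p (tail G e)"
    using strongly_connected_awalk[OF assms(1)] assms(2) by (metis head_in_verts tail_in_verts)
  then have "awalk (tail G e) (e # p) (tail G e)"
    using assms by (simp add: awalk_Cons_iff)
  then show ?thesis by (intro exI[of _ "e # p"]) (auto simp: closed_w_def)
qed

text \<open>The average, over all arcs, of closed walks through the respective arc.\<close>

lemma ex_positive_flow:
  assumes sc: "strongly_connected G" and ne: "arcs G \<noteq> {}"
  shows "\<exists>z\<in>flow_polytope. \<forall>e\<in>arcs G. 0 < Poly_Mapping.lookup z e"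
proof -
  obtain c where c: "\<And>e. e \<in> arcs G \<Longrightarrow> closed_w (c e) \<and> e \<in> set (c e)"
    using ex_closed_walk_through[OF sc] by metis
  define z where "z = (\<Sum>e\<in>arcs G. (1 / real (card (arcs G))) *\<^sub>R cycle_vec (c e))"
  have pos: "0 < card (arcs G)" using ne by (simp add: card_gt_0_iff)
  have "z \<in> flow_polytope"
    unfolding z_def using pos c
    by (intro convex_sum convex_flow_polytope) (auto intro: cycle_vec_in_flow_polytope)
  moreover have "0 < Poly_Mapping.lookup z e" if e: "e \<in> arcs G" for e
  proof -
    have "count_list (c e) e \<noteq> 0" "length (c e) \<noteq> 0"
      using c[OF e] by (auto simp: count_list_0_iff)
    then have "0 < Poly_Mapping.lookup (cycle_vec (c e)) e"
      by (simp add: cycle_vec.rep_eq zero_less_divide_iff)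
    then show ?thesis
      unfolding z_def lookup_sum using e pos
      by (intro sum_pos2[of _ e]) (simp_all add: cycle_vec.rep_eq zero_less_divide_iff zero_less_mult_iff)
  qed
  ultimately show ?thesis by blast
qed

text \<open>The differences of flows span the kernel of the total and the balance equations. The
  redundant equation at \<open>r\<close> cedes its place to \<open>total\<close>, which leaves one
  functional per vertex.\<close>

lemma affine_dimension_flow_polytope:
  assumes sc: "strongly_connected G" and ne: "arcs G \<noteq> {}"
  shows "affine_dimension flow_polytope + card (verts G) = card (arcs G)"
proof -
  let ?A = "(\<lambda>e. Poly_Mapping.single e (1::real)) ` arcs G"
  obtain r where r: "r \<in> verts G" using sc by (auto simp: strongly_connected_def)
  define f where "f u = (if u = r then total else (\<lambda>v. netflow v u))" for u
  obtain p where p: "\<And>u. u \<in> verts G \<Longrightarrow> awalk u (p u) r"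
    using strongly_connected_awalk[OF sc _ r] by metis
  obtain C where C: "closed_w C"
    using ne ex_closed_walk_through[OF sc] by blast
  then have Cf: "cycle_vec C \<in> flow_polytope" by (rule cycle_vec_in_flow_polytope)
  \<comment> \<open>Dual vectors: a walk from \<open>u\<close> to \<open>r\<close> has net flow 1 at
    \<open>u\<close> and -1 at \<open>r\<close>, where no balance is tested; subtracting a multiple
    of \<open>cycle_vec C\<close> makes its total 0.\<close>
  define w where "w u = (if u = r then cycle_vec C
     else arc_vec (p u) - real (length (p u)) *\<^sub>R cycle_vec C)" for u
  have pG: "set (p u) \<subseteq> arcs G" if "u \<in> verts G" for u using p[OF that] by auto
  let ?K = "{x \<in> span ?A. \<forall>u\<in>verts G. f u x = 0}"
  have dimK: "dim ?K + card (verts G) = card ?A"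
  proof (rule dim_common_kernel)
    show "independent ?A" by (simp add: independent_singles)
    show "linear (f u)" for u
      unfolding f_def by (simp add: linear_total linear_netflow)
    have CA: "cycle_vec C \<in> span ?A" using Cf by (simp add: span_singles flow_polytope_def)
    show "w u \<in> span ?A" if "u \<in> verts G" for u
    proof -
      have "arc_vec (p u) \<in> span ?A" using pG[OF that] by (simp add: span_singles)
      then show ?thesis unfolding w_def using CA by (auto intro: span_diff span_scale)
    qed
    show "f u (w u') = of_bool (u = u')" if "u \<in> verts G" "u' \<in> verts G" for u u'
      using that Cf
      by (auto simp: f_def w_def flow_polytope_def total_arc_vec[OF pG] netflow_arc_vec[OF p])
  qed auto
  let ?D = "{x - y | x y. x \<in> flow_polytope \<and> y \<in> flow_polytope}"
  have K: "x \<in> ?K \<longleftrightarrow> Poly_Mapping.keys x \<subseteq> arcs G \<and> total x = 0 \<and> (\<forall>w\<in>verts G. netflow x w = 0)" for x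
  proof -
    have "netflow x r = 0" if "\<forall>u\<in>verts G - {r}. netflow x u = 0"
      using sum_netflow[of x] that r by (simp add: sum.remove[of _ r])
    then show ?thesis using r
      by (auto simp: span_singles f_def)
  qed
  have "?D \<subseteq> ?K"
  proof
    fix d assume "d \<in> ?D"
    then obtain x y where "d = x - y" "x \<in> flow_polytope" "y \<in> flow_polytope" by blast
    then show "d \<in> ?K" unfolding K using keys_diff[of x y] by (auto simp: flow_polytope_def)
  qed
  moreover have "?K \<subseteq> span ?D"
  proof
    fix x assume x: "x \<in> ?K"
    obtain z where z: "z \<in> flow_polytope" "\<And>e. e \<in> arcs G \<Longrightarrow> 0 < Poly_Mapping.lookup z e"
      using ex_positive_flow[OF sc ne] by blast
    \<comment> \<open>Small enough for \<open>z + \<epsilon> *\<^sub>R x\<close> to stay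
      nonnegative; the added 1 keeps the denominators positive.\<close>
    define \<epsilon> where "\<epsilon> = Min ((\<lambda>e. Poly_Mapping.lookup z e / (\<bar>Poly_Mapping.lookup x e\<bar> + 1)) ` arcs G)"
    have "\<epsilon> \<in> (\<lambda>e. Poly_Mapping.lookup z e / (\<bar>Poly_Mapping.lookup x e\<bar> + 1)) ` arcs G"
      unfolding \<epsilon>_def using ne by (intro Min_in) auto
    then have "0 < \<epsilon>" using z(2) by (auto intro!: divide_pos_pos)
    have "0 \<le> Poly_Mapping.lookup z e + \<epsilon> * Poly_Mapping.lookup x e" for e
    proof (cases "e \<in> arcs G")
      case True
      then have "\<epsilon> \<le> Poly_Mapping.lookup z e / (\<bar>Poly_Mapping.lookup x e\<bar> + 1)"
        unfolding \<epsilon>_def by (intro Min_le) auto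
      then have "\<epsilon> * (\<bar>Poly_Mapping.lookup x e\<bar> + 1) \<le> Poly_Mapping.lookup z e"
        by (simp add: field_simps)
      moreover have "- (\<epsilon> * Poly_Mapping.lookup x e) \<le> \<epsilon> * (\<bar>Poly_Mapping.lookup x e\<bar> + 1)"
        using mult_left_mono[of "- Poly_Mapping.lookup x e" "\<bar>Poly_Mapping.lookup x e\<bar> + 1" \<epsilon>] \<open>0 < \<epsilon>\<close>
        by simp
      ultimately show ?thesis by linarith
    next
      case False
      then have "Poly_Mapping.lookup x e = 0" "Poly_Mapping.lookup z e = 0"
        using x z(1) unfolding K by (auto simp: flow_polytope_def in_keys_iff subset_iff)
      then show ?thesis by simp
    qed
    moreover have "Poly_Mapping.keys (z + \<epsilon> *\<^sub>R x) \<subseteq> arcs G"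
      using x z(1) unfolding K by (auto simp: flow_polytope_def in_keys_iff lookup_add subset_iff) (metis add.right_neutral mult_zero_right)
    ultimately have "z + \<epsilon> *\<^sub>R x \<in> flow_polytope"
      using x z(1) unfolding K by (simp add: flow_polytope_def lookup_add)
    then have "(z + \<epsilon> *\<^sub>R x) - z \<in> ?D" using z(1) by blast
    then have "(1 / \<epsilon>) *\<^sub>R ((z + \<epsilon> *\<^sub>R x) - z) \<in> span ?D" by (intro span_scale span_base)
    then show "x \<in> span ?D" using \<open>0 < \<epsilon>\<close> by simp
  qed
  ultimately have "span ?K = span ?D"
    by (intro antisym span_mono span_minimal subspace_span)
  then have "dim ?K = dim ?D" by (rule span_eq_dim)
  then show ?thesis using dimK by (simp add: affine_dimension_def card_singles)
qed


end

section \<open>Approximating flows by closed walks\<close>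

lemma count_list_concat_replicate: "count_list (concat (replicate n c)) e = n * count_list c e"
  by (induction n) auto

lemma length_concat_replicate: "length (concat (replicate n c)) = n * length c"
  by (induction n) auto

text \<open>An error bounded independently of \<open>m\<close> is lost on division by
  \<open>m\<close>.\<close>

lemma LIMSEQ_of_bounded_difference:
  fixes f :: "nat \<Rightarrow> real"
  assumes "\<And>m. \<bar>f m - real m * x\<bar> \<le> K"
  shows "(\<lambda>m. f m / real m) \<longlonglongrightarrow> x"
proof -
  have "(\<lambda>m. K / real m) \<longlonglongrightarrow> 0" by (rule lim_const_over_n)
  moreover have "eventually (\<lambda>m. norm (f m / real m - x) \<le> K / real m) sequentially"
    using eventually_gt_at_top[of 0]
  proof eventually_elim
    case (elim m)
    then have "f m / real m - x = (f m - real m * x) / real m" by (simp add: field_simps)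
    then show ?case using assms[of m] by (simp add: divide_right_mono)
  qed
  ultimately have "(\<lambda>m. f m / real m - x) \<longlonglongrightarrow> 0"
    by (rule Lim_null_comparison[rotated])
  then show ?thesis by (simp add: LIM_zero_iff)
qed

context fin_digraph
begin

text \<open>A common base point \<open>r\<close> lets walks be concatenated, and the error
  \<open>K\<close> is uniform in \<open>m\<close> and \<open>e\<close>. The bound 1 on the
  coordinates controls rounding when \<open>m\<close> is split in proportion.\<close>

definition approximable :: "'a \<Rightarrow> ('b \<Rightarrow>\<^sub>0 real) set" where
  "approximable r = {v. (\<forall>e. \<bar>Poly_Mapping.lookup v e\<bar> \<le> 1) \<and>
     (\<exists>K. \<forall>m::nat. \<exists>p. awalk r p r \<and> \<bar>real (length p) - real m\<bar> \<le> K \<and>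
       (\<forall>e. \<bar>real (count_list p e) - real m * Poly_Mapping.lookup v e\<bar> \<le> K))}"

text \<open>Concatenate the walks chosen for the integer parts of \<open>a * m\<close> and
  \<open>b * m\<close>. Each rounding costs at most 1, whence \<open>K + L + 2\<close>.\<close>

lemma convex_approximable: "convex (approximable r)"
  unfolding convex_def
proof (intro ballI allI impI)
  fix x y :: "'b \<Rightarrow>\<^sub>0 real" and a b :: real
  assume x: "x \<in> approximable r" and y: "y \<in> approximable r" and ab: "0 \<le> a" "0 \<le> b" "a + b = 1"
  have x1: "\<bar>Poly_Mapping.lookup x e\<bar> \<le> 1" and y1: "\<bar>Poly_Mapping.lookup y e\<bar> \<le> 1" for e
    using x y by (auto simp: approximable_def)
  from x obtain K p where p: "\<And>m. awalk r (p m) r" "\<And>m. \<bar>real (length (p m)) - real m\<bar> \<le> K"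
      "\<And>m e. \<bar>real (count_list (p m) e) - real m * Poly_Mapping.lookup x e\<bar> \<le> K"
    unfolding approximable_def by (clarsimp simp: choice_iff) blast
  from y obtain L q where q: "\<And>m. awalk r (q m) r" "\<And>m. \<bar>real (length (q m)) - real m\<bar> \<le> L"
      "\<And>m e. \<bar>real (count_list (q m) e) - real m * Poly_Mapping.lookup y e\<bar> \<le> L"
    unfolding approximable_def by (clarsimp simp: choice_iff) blast
  show "a *\<^sub>R x + b *\<^sub>R y \<in> approximable r"
    unfolding approximable_def mem_Collect_eq
  proof (intro conjI allI exI[of _ "K + L + 2"])
    fix e
    have "\<bar>a * Poly_Mapping.lookup x e\<bar> \<le> a" "\<bar>b * Poly_Mapping.lookup y e\<bar> \<le> b"
      using x1[of e] y1[of e] ab by (simp_all add: abs_mult mult_left_le)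
    then show "\<bar>Poly_Mapping.lookup (a *\<^sub>R x + b *\<^sub>R y) e\<bar> \<le> 1"
      using ab by (simp add: lookup_add)
  next
    fix m :: nat
    define s t where "s = nat \<lfloor>a * real m\<rfloor>" and "t = nat \<lfloor>b * real m\<rfloor>"
    have s: "\<bar>real s - a * real m\<bar> \<le> 1" and t: "\<bar>real t - b * real m\<bar> \<le> 1"
      using ab by (auto simp: s_def t_def) linarith+
    have walk: "awalk r (p s @ q t) r"
      using p(1) q(1) awalk_appendI by blast
    have m: "real m = a * real m + b * real m" using ab by (simp flip: distrib_right)
    have len: "\<bar>real (length (p s @ q t)) - real m\<bar> \<le> K + L + 2"
      using p(2)[of s] q(2)[of t] s t m by simp
    have cnt: "\<bar>real (count_list (p s @ q t) e) - real m * Poly_Mapping.lookup (a *\<^sub>R x + b *\<^sub>R y) e\<bar> \<le> K + L + 2" for e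
    proof -
      have "\<bar>(real s - a * real m) * Poly_Mapping.lookup x e\<bar> \<le> 1 * 1"
        unfolding abs_mult by (intro mult_mono s x1) auto
      moreover have "\<bar>(real t - b * real m) * Poly_Mapping.lookup y e\<bar> \<le> 1 * 1"
        unfolding abs_mult by (intro mult_mono t y1) auto
      ultimately show ?thesis
        using p(3)[of s e] q(3)[of t e] by (simp add: lookup_add algebra_simps)
    qed
    show "\<exists>p. awalk r p r \<and> \<bar>real (length p) - real m\<bar> \<le> K + L + 2 \<and>
        (\<forall>e. \<bar>real (count_list p e) - real m * Poly_Mapping.lookup (a *\<^sub>R x + b *\<^sub>R y) e\<bar> \<le> K + L + 2)"
      using walk len cnt by blast
  qed
qed

lemma awalk_concat_replicate:
  assumes "awalk u c u"
  shows "awalk u (concat (replicate n c)) u"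
proof (induction n)
  case 0
  then show ?case using assms by (auto simp: awalk_Nil_iff)
next
  case (Suc n)
  then show ?case using awalk_appendI[OF assms Suc] by simp
qed

text \<open>Travel from \<open>r\<close> to \<open>C\<close>, wind around it
  \<open>m div length C\<close> times and return. The error is at most the two connecting walks plus
  one incomplete turn.\<close>

lemma cycle_vec_approximable:
  assumes sc: "strongly_connected G" and r: "r \<in> verts G" and C: "closed_w C"
  shows "cycle_vec C \<in> approximable r"
proof -
  obtain u where u: "awalk u C u" "C \<noteq> []" using C by (auto simp: closed_w_def)
  then have uG: "u \<in> verts G" by auto
  obtain p q where p: "awalk r p u" and q: "awalk u q r"
    using strongly_connected_awalk[OF sc] r uG by metis
  define c where "c e = Poly_Mapping.lookup (cycle_vec C) e" for e
  have c: "real (count_list C e) = c e * real (length C)" "0 \<le> c e" "c e \<le> 1" for e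
    using u(2) count_le_length[of C e] by (auto simp: c_def cycle_vec.rep_eq)
  show ?thesis
    unfolding approximable_def mem_Collect_eq
  proof (intro conjI allI exI[of _ "real (length p + length q + length C)"])
    show "\<bar>Poly_Mapping.lookup (cycle_vec C) e\<bar> \<le> 1" for e
      using c[of e] by (simp add: c_def)
    fix m :: nat
    define j where "j = m div length C"
    define P where "P = p @ concat (replicate j C) @ q"
    have walk: "awalk r P r"
      unfolding P_def by (intro awalk_appendI[OF p] awalk_appendI[OF _ q] awalk_concat_replicate u)
    have "j * length C + m mod length C = m" "m mod length C < length C"
      using u(2) by (simp_all add: j_def)
    then have j: "real j * real (length C) \<le> real m" "real m \<le> real j * real (length C) + real (length C)"
      by (metis le_add1 of_nat_le_iff of_nat_mult, metis add_le_cancel_left less_imp_le of_nat_add of_nat_le_iff of_nat_mult)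
    have len: "\<bar>real (length P) - real m\<bar> \<le> real (length p + length q + length C)"
      using j by (simp add: P_def length_concat_replicate)
    have cnt: "\<bar>real (count_list P e) - real m * Poly_Mapping.lookup (cycle_vec C) e\<bar>
        \<le> real (length p + length q + length C)" for e
    proof -
      have "\<bar>(real j * real (length C) - real m) * c e\<bar> \<le> real (length C) * 1"
        unfolding abs_mult by (intro mult_mono) (use c[of e] j in auto)
      moreover have "real (count_list P e) = real (count_list p e) + real (count_list q e) + real j * real (length C) * c e"
        by (simp add: P_def count_list_concat_replicate c(1))
      ultimately show ?thesis
        using count_le_length[of p e] count_le_length[of q e]
        by (simp add: c_def[symmetric] algebra_simps)
    qed
    show "\<exists>p'. awalk r p' r \<and> \<bar>real (length p') - real m\<bar> \<le> real (length p + length q + length C) \<and>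
        (\<forall>e. \<bar>real (count_list p' e) - real m * Poly_Mapping.lookup (cycle_vec C) e\<bar>
          \<le> real (length p + length q + length C))"
      using walk len cnt by blast
  qed
qed

text \<open>The approximable vectors form a convex set that contains all generators of the cycle
  polytope. A constant shift \<open>c\<close> of the length does not affect the limit.\<close>

lemma ex_awalks_tendsto:
  assumes sc: "strongly_connected G" and r: "r \<in> verts G" and v: "v \<in> flow_polytope"
  obtains p where "\<And>m. awalk r (p m) r" "filterlim (\<lambda>m. length (p m)) at_top sequentially"
    "\<And>e. (\<lambda>m. real (count_list (p m) e) / (real (length (p m)) + c)) \<longlonglongrightarrow> Poly_Mapping.lookup v e"
proof -
  have "cycle_polytope G \<subseteq> approximable r"
    unfolding cycle_polytope_def
    using cycle_vec_approximable[OF sc r] cycle_imp_closed_w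
    by (intro hull_minimal convex_approximable) auto
  then have "v \<in> approximable r" using v flow_polytope_eq_cycle_polytope by auto
  then obtain K p where p: "\<And>m. awalk r (p m) r" "\<And>m. \<bar>real (length (p m)) - real m\<bar> \<le> K"
      "\<And>m e. \<bar>real (count_list (p m) e) - real m * Poly_Mapping.lookup v e\<bar> \<le> K"
    unfolding approximable_def by (clarsimp simp: choice_iff) blast
  have "filterlim (\<lambda>m. - K + real m) at_top sequentially"
    by (intro filterlim_tendsto_add_at_top[OF tendsto_const] filterlim_real_sequentially)
  then have "filterlim (\<lambda>m. real (length (p m))) at_top sequentially"
    by (rule filterlim_at_top_mono) (use p(2) in \<open>auto intro!: always_eventually simp: abs_le_iff algebra_simps\<close>)
  then have lim: "filterlim (\<lambda>m. length (p m)) at_top sequentially"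
    unfolding filterlim_at_top
    by (metis (mono_tags, lifting) eventually_mono of_nat_le_iff)
  have "(\<lambda>m. (real (length (p m)) + c) / real m) \<longlonglongrightarrow> 1"
  proof (rule LIMSEQ_of_bounded_difference)
    show "\<bar>(real (length (p m)) + c) - real m * 1\<bar> \<le> K + \<bar>c\<bar>" for m
      using p(2)[of m] by linarith
  qed
  note len_lim = this
  have "(\<lambda>m. real (count_list (p m) e) / (real (length (p m)) + c)) \<longlonglongrightarrow> Poly_Mapping.lookup v e" for e
  proof (rule Lim_transform_eventually)
    have "(\<lambda>m. real (count_list (p m) e) / real m) \<longlonglongrightarrow> Poly_Mapping.lookup v e"
      by (rule LIMSEQ_of_bounded_difference) (rule p(3))
    from tendsto_divide[OF this len_lim]
    show "(\<lambda>m. (real (count_list (p m) e) / real m) / ((real (length (p m)) + c) / real m))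
        \<longlonglongrightarrow> Poly_Mapping.lookup v e"
      by simp
    show "eventually (\<lambda>m. (real (count_list (p m) e) / real m) / ((real (length (p m)) + c) / real m) =
        real (count_list (p m) e) / (real (length (p m)) + c)) sequentially"
      using eventually_gt_at_top[of 0] by eventually_elim simp
  qed
  with p(1) lim show thesis by (rule that)
qed

end

section \<open>Walks in the overlap graph\<close>

lemma permsD:
  assumes "\<pi> \<in> perms n"
  shows "distinct \<pi>" "set \<pi> = {1..n}" "length \<pi> = n"
  using assms length_perms by (auto simp: perms_def permutations_of_set_def)

lemma same_relative_order_refl: "same_relative_order xs xs"
  by (simp add: same_relative_order_def)

lemma same_relative_order_sym: "same_relative_order xs ys \<Longrightarrow> same_relative_order ys xs"
  by (simp add: same_relative_order_def)

lemma same_relative_order_trans: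
  "same_relative_order xs ys \<Longrightarrow> same_relative_order ys zs \<Longrightarrow> same_relative_order xs zs"
  by (simp add: same_relative_order_def)

lemma same_relative_order_length: "same_relative_order xs ys \<Longrightarrow> length xs = length ys"
  by (simp add: same_relative_order_def)

lemma same_relative_order_take:
  "same_relative_order xs ys \<Longrightarrow> same_relative_order (take n xs) (take n ys)"
  by (simp add: same_relative_order_def)

lemma same_relative_order_drop:
  "same_relative_order xs ys \<Longrightarrow> same_relative_order (drop n xs) (drop n ys)"
  by (simp add: same_relative_order_def)

lemma same_relative_order_map:
  assumes "strict_mono f"
  shows "same_relative_order (map f xs) xs"
  using assms by (simp add: same_relative_order_def strict_mono_less)

text \<open>Both lists have the relative order of the permutation \<open>std ys\<close>, and a
  permutation is determined by its relative order.\<close>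

lemma std_cong:
  assumes "same_relative_order xs ys" "distinct ys"
  shows "std xs = std ys"
  using std_eq_if_same_relative_order[OF same_relative_order_trans[OF assms(1) same_relative_order_std] std_in_perms[OF assms(2)]] .

lemma std_perms: "\<pi> \<in> perms n \<Longrightarrow> std \<pi> = \<pi>"
  by (rule std_eq_if_same_relative_order[OF same_relative_order_refl])

lemma same_relative_order_iff_std:
  assumes "\<pi> \<in> perms n"
  shows "same_relative_order xs \<pi> \<longleftrightarrow> std xs = \<pi>"
  using std_eq_if_same_relative_order[OF _ assms] same_relative_order_std[of xs] by auto

section \<open>Windows of a list as walks in the overlap graph\<close>

text \<open>The number of windows is \<open>length \<sigma> + 1 - k\<close>, which truncated
  subtraction makes 0 when \<open>\<sigma>\<close> is shorter than \<open>k\<close>.\<close>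

definition pattern_walk :: "nat \<Rightarrow> nat list \<Rightarrow> nat list list" where
  "pattern_walk k \<sigma> = map (\<lambda>i. std (take k (drop i \<sigma>))) [0..<length \<sigma> + 1 - k]"

lemma length_pattern_walk [simp]: "length (pattern_walk k \<sigma>) = length \<sigma> + 1 - k"
  by (simp add: pattern_walk_def)

lemma count_list_pattern_walk:
  assumes "\<pi> \<in> perms k"
  shows "count_list (pattern_walk k \<sigma>) \<pi> = c_occ \<pi> \<sigma>"
proof -
  have len: "length \<pi> = k" using permsD assms by blast
  show ?thesis
    unfolding c_occ_def count_list_eq_length_filter length_filter_conv_card len
      same_relative_order_iff_std[OF assms]
    by (rule arg_cong[of _ _ card]) (auto simp: pattern_walk_def)
qed

text \<open>Lets a distinct list be constructed first and turned into a permutation at the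
  end.\<close>

lemma pattern_walk_std:
  assumes "distinct \<sigma>"
  shows "pattern_walk k (std \<sigma>) = pattern_walk k \<sigma>"
proof -
  have "std (take k (drop i (std \<sigma>))) = std (take k (drop i \<sigma>))" for i
    using assms
    by (intro std_cong same_relative_order_take same_relative_order_drop
        same_relative_order_sym[OF same_relative_order_std]) auto
  then show ?thesis by (simp add: pattern_walk_def std_def)
qed

lemma overlap_graph_simps [simp]:
  "verts (overlap_graph k) = perms (k - 1)"
  "arcs (overlap_graph k) = perms k"
  "tail (overlap_graph k) \<pi> = std (take (k - 1) \<pi>)"
  "head (overlap_graph k) \<pi> = std (drop 1 \<pi>)"
  by (simp_all add: overlap_graph_def)

lemma fin_digraph_overlap_graph:
  assumes "0 < k"
  shows "fin_digraph (overlap_graph k)"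
proof -
  interpret wf_digraph "overlap_graph k" by (rule wf_overlap_graph[OF assms])
  show ?thesis by unfold_locales (simp_all add: finite_perms)
qed

text \<open>Consecutive windows share \<open>k - 1\<close> entries, whose pattern is the head of one
  arc and the tail of the next.\<close>

lemma awalk_pattern_walk:
  assumes k: "0 < k" and "distinct \<sigma>" "k - 1 \<le> length \<sigma>"
  shows "pre_digraph.awalk (overlap_graph k) (std (take (k - 1) \<sigma>)) (pattern_walk k \<sigma>)
           (std (drop (length \<sigma> - (k - 1)) \<sigma>))"
proof -
  interpret fin_digraph "overlap_graph k" by (rule fin_digraph_overlap_graph[OF k])
  show ?thesis
    using assms(2,3)
  proof (induction \<sigma>)
    case Nil
    then show ?case using k std_in_perms[of "[]"]
      by (simp add: awalk_Nil_iff pattern_walk_def)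
  next
    case (Cons x \<sigma>)
    show ?case
    proof (cases "k \<le> length (x # \<sigma>)")
      \<comment> \<open>With only \<open>k - 1\<close> entries there is no window: the walk is empty
        and its endpoints coincide.\<close>
      case False
      then have len: "length (x # \<sigma>) = k - 1" using Cons by simp
      then have "pattern_walk k (x # \<sigma>) = []" using k by (simp add: pattern_walk_def)
      then show ?thesis using len std_in_perms[OF Cons.prems(1)]
        by (simp add: awalk_Nil_iff)
    next
      case True
      let ?\<pi> = "std (take k (x # \<sigma>))"
      have "length (x # \<sigma>) + 1 - k = Suc (length \<sigma> + 1 - k)" using True by simp
      then have pw: "pattern_walk k (x # \<sigma>) = ?\<pi> # pattern_walk k \<sigma>"
        unfolding pattern_walk_def by (simp only: map_upt_Suc drop_0 drop_Suc_Cons)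
      have d: "distinct (take k (x # \<sigma>))" using Cons.prems(1) distinct_take by blast
      have \<pi>: "?\<pi> \<in> perms k" using std_in_perms[OF d] True by (simp add: min_absorb2)
      have eq: "take (k - 1) (take k (x # \<sigma>)) = take (k - 1) (x # \<sigma>)"
        "drop 1 (take k (x # \<sigma>)) = take (k - 1) \<sigma>"
        using k by (simp_all add: take_Cons' drop_take)
      have t: "std (take (k - 1) ?\<pi>) = std (take (k - 1) (x # \<sigma>))"
        unfolding eq(1)[symmetric] using d
        by (intro std_cong same_relative_order_take same_relative_order_sym[OF same_relative_order_std])
           (rule distinct_take)
      have h: "std (drop 1 ?\<pi>) = std (take (k - 1) \<sigma>)"
        unfolding eq(2)[symmetric] using d
        by (intro std_cong same_relative_order_drop same_relative_order_sym[OF same_relative_order_std])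
           (rule distinct_drop)
      have dr: "drop (length (x # \<sigma>) - (k - 1)) (x # \<sigma>) = drop (length \<sigma> - (k - 1)) \<sigma>"
        using True k by (simp add: Suc_diff_le)
      have "awalk (std (take (k - 1) \<sigma>)) (pattern_walk k \<sigma>) (std (drop (length \<sigma> - (k - 1)) \<sigma>))"
        using Cons True by simp
      then show ?thesis
        unfolding pw awalk_Cons_iff dr using \<pi> t h by simp
    qed
  qed
qed

text \<open>Append to \<open>u\<close> a copy of \<open>v\<close> shifted by \<open>k\<close>, which
  is disjoint from \<open>u\<close>; the windows of this list lead from \<open>u\<close> to
  \<open>v\<close>.\<close>

lemma strongly_connected_overlap_graph:
  assumes k: "0 < k"
  shows "strongly_connected (overlap_graph k)"
proof -
  interpret fin_digraph "overlap_graph k" by (rule fin_digraph_overlap_graph[OF k])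
  have "perms (k - 1) \<noteq> {}" using std_in_perms[of "[0..<k-1]"] by auto
  moreover have "u \<rightarrow>\<^sup>*\<^bsub>overlap_graph k\<^esub> v" if u: "u \<in> perms (k - 1)" and v: "v \<in> perms (k - 1)" for u v
  proof -
    let ?\<sigma> = "u @ map (\<lambda>x. x + k) v"
    have "distinct ?\<sigma>" using permsD[OF u] permsD[OF v] by (auto simp: distinct_map)
    from awalk_pattern_walk[OF k this]
    have "awalk (std u) (pattern_walk k ?\<sigma>) (std (map (\<lambda>x. x + k) v))"
      using permsD[OF u] permsD[OF v] by simp
    moreover have "std (map (\<lambda>x. x + k) v) = std v"
      using permsD[OF v] by (intro std_cong same_relative_order_map) (auto simp: strict_mono_def)
    ultimately show ?thesis
      using std_perms u v reachable_awalk by auto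
  qed
  ultimately show ?thesis by (simp add: strongly_connected_def)
qed

text \<open>Doubling the entries leaves room for a new last entry in every position relative to the old ones.\<close>

lemma ex_same_relative_order_snoc:
  assumes ord: "same_relative_order xs ys" and q: "q \<notin> set ys"
  shows "\<exists>m. same_relative_order (map (\<lambda>a. 2 * a + 1) xs @ [2 * m]) (ys @ [q])"
proof -
  let ?S = "{xs ! a | a. a < length xs \<and> ys ! a < q}"
  \<comment> \<open>One above the largest old entry that must stay below the new one, and 0 if there
    is none; \<open>2 * x + 1 < 2 * m\<close> means \<open>x < m\<close>.\<close>
  define m where "m = Max (insert 0 (Suc ` ?S))"
  have fin: "finite (insert 0 (Suc ` ?S))" by simp
  have len: "length xs = length ys" using ord by (rule same_relative_order_length)
  have less: "2 * (xs ! a) + 1 < 2 * m \<longleftrightarrow> ys ! a < q" if a: "a < length ys" for a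
  proof
    assume "ys ! a < q"
    then have "Suc (xs ! a) \<in> insert 0 (Suc ` ?S)" using a len by auto
    then have "Suc (xs ! a) \<le> m" unfolding m_def by (rule Max_ge[OF fin])
    then show "2 * (xs ! a) + 1 < 2 * m" by simp
  next
    assume "2 * (xs ! a) + 1 < 2 * m"
    then have "xs ! a < m" by simp
    moreover have "m \<in> insert 0 (Suc ` ?S)" unfolding m_def by (intro Max_in fin) simp
    ultimately obtain b where b: "b < length xs" "ys ! b < q" "xs ! a \<le> xs ! b" by auto
    then have "ys ! a \<le> ys ! b"
      using ord a len by (auto simp: same_relative_order_def not_less[symmetric])
    with b show "ys ! a < q" by simp
  qed
  have neq: "ys ! a \<noteq> q" if "a < length ys" for a using q that by auto
  have greater: "2 * m < 2 * (xs ! a) + 1 \<longleftrightarrow> q < ys ! a" if a: "a < length ys" for a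
    using less[OF a] neq[OF a] by presburger
  define f where "f a = 2 * a + 1" for a :: nat
  have "f x < f y \<longleftrightarrow> x < y" for x y by (simp add: f_def)
  then have "same_relative_order (map f xs @ [2 * m]) (ys @ [q])"
    unfolding same_relative_order_def
    using ord len less[folded f_def] greater[folded f_def]
    by (auto simp: same_relative_order_def nth_append less_Suc_eq)
  then have "same_relative_order (map (\<lambda>a. 2 * a + 1) xs @ [2 * m]) (ys @ [q])"
    by (simp add: f_def[abs_def])
  then show ?thesis ..
qed

text \<open>Each arc adds one last entry. The final clause records the pattern of the last
  \<open>k - 1\<close> entries, which is the tail of the next arc and makes the next insertion
  possible.\<close>

lemma awalk_overlap_graph_lift:
  assumes k: "0 < k" and "pre_digraph.awalk (overlap_graph k) u p v"
  shows "\<exists>\<sigma>. distinct \<sigma> \<and> length \<sigma> = length p + (k - 1) \<and> pattern_walk k \<sigma> = p \<and>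
           std (drop (length p) \<sigma>) = v"
proof -
  interpret fin_digraph "overlap_graph k" by (rule fin_digraph_overlap_graph[OF k])
  show ?thesis
    using assms(2)
  proof (induction p arbitrary: v rule: rev_induct)
    case Nil
    then have "u \<in> perms (k - 1)" "v = u"
      by (auto simp: awalk_Nil_iff)
    then show ?case using permsD[of u "k - 1"] std_perms[of u "k - 1"] k
      by (intro exI[of _ u]) (auto simp: pattern_walk_def)
  next
    case (snoc \<pi> p)
    from snoc.prems obtain v' where "awalk u p v'" and
      "awalk v' [\<pi>] v" by (auto simp del: awalk_Cons_iff)
    then have \<pi>: "\<pi> \<in> perms k" and v': "v' = std (take (k - 1) \<pi>)" and v: "v = std (drop 1 \<pi>)"
      by (auto simp: awalk_Cons_iff awalk_Nil_iff)
    obtain \<sigma> where \<sigma>: "distinct \<sigma>" "length \<sigma> = length p + (k - 1)" "pattern_walk k \<sigma> = p"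
      "std (drop (length p) \<sigma>) = v'"
      using snoc.IH[OF \<open>awalk u p v'\<close>] by blast
    let ?f = "\<lambda>a::nat. 2 * a + 1"
    have mono: "strict_mono ?f" by (auto simp: strict_mono_def)
    \<comment> \<open>The walk has reached the tail of \<open>\<pi>\<close>, so the last
      \<open>k - 1\<close> entries are already ordered like the beginning of \<open>\<pi>\<close>;
      only \<open>last \<pi>\<close> remains to be placed.\<close>
    have ord: "same_relative_order (drop (length p) \<sigma>) (take (k - 1) \<pi>)"
      using same_relative_order_std[of "drop (length p) \<sigma>"]
        same_relative_order_sym[OF same_relative_order_std[of "take (k - 1) \<pi>"]]
      unfolding \<sigma>(4) v' by (rule same_relative_order_trans)
    have split: "\<pi> = take (k - 1) \<pi> @ [last \<pi>]"
      using permsD[OF \<pi>] k by (metis append_butlast_last_id butlast_conv_take length_greater_0_conv)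
    then have "last \<pi> \<notin> set (take (k - 1) \<pi>)"
      using permsD(1)[OF \<pi>] by (metis distinct_append disjoint_insert(1) list.simps(15))
    from ex_same_relative_order_snoc[OF ord this] split obtain m
      where m: "same_relative_order (map ?f (drop (length p) \<sigma>) @ [2 * m]) \<pi>" by auto
    define \<tau> where "\<tau> = map ?f \<sigma> @ [2 * m]"
    have dist: "distinct \<tau>"
      using \<sigma>(1) by (auto simp: \<tau>_def distinct_map inj_on_def) presburger
    have len: "length \<tau> = length (p @ [\<pi>]) + (k - 1)" by (simp add: \<tau>_def \<sigma>(2))
    have drop_\<tau>: "drop (length p) \<tau> = map ?f (drop (length p) \<sigma>) @ [2 * m]"
      by (simp add: \<tau>_def \<sigma>(2) drop_map)
    have std_last: "std (drop (length p) \<tau>) = \<pi>"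
      unfolding drop_\<tau> by (rule std_eq_if_same_relative_order[OF m \<pi>])
    \<comment> \<open>A window that starts before \<open>length p\<close> misses the new entry, and
      \<open>?f\<close> preserves the order of the old ones.\<close>
    have old: "std (take k (drop i \<tau>)) = std (take k (drop i \<sigma>))" if "i < length p" for i
    proof -
      have "take k (drop i \<tau>) = map ?f (take k (drop i \<sigma>))"
        using that \<sigma>(2) k by (simp add: \<tau>_def take_map drop_map)
      also have "std \<dots> = std (take k (drop i \<sigma>))"
        using \<sigma>(1) by (intro std_cong same_relative_order_map mono) auto
      finally show ?thesis .
    qed
    have lp: "length \<sigma> + 1 - k = length p" using \<sigma>(3) length_pattern_walk by metis
    have "pattern_walk k \<tau> = map (\<lambda>i. std (take k (drop i \<tau>))) [0..<Suc (length p)]"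
      unfolding pattern_walk_def using len k by simp
    also have "\<dots> = map (\<lambda>i. std (take k (drop i \<sigma>))) [0..<length p] @ [std (take k (drop (length p) \<tau>))]"
      using old by simp
    also have "map (\<lambda>i. std (take k (drop i \<sigma>))) [0..<length p] = p"
      using \<sigma>(3) unfolding pattern_walk_def lp .
    also have "take k (drop (length p) \<tau>) = drop (length p) \<tau>" using len k by simp
    finally have pw: "pattern_walk k \<tau> = p @ [\<pi>]" using std_last by simp
    have "std (drop (length (p @ [\<pi>])) \<tau>) = std (drop 1 (drop (length p) \<tau>))"
      by simp
    also have "\<dots> = v"
      unfolding v drop_\<tau> using m permsD[OF \<pi>] by (intro std_cong same_relative_order_drop) auto
    finally show ?case using dist len pw by blast
  qed
qed

section \<open>The feasible region\<close>

text \<open>The arc counts of window walks satisfy the flow equations up to bounded errors, which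
  vanish after division by the size.\<close>

lemma feasible_region_subset_flow_polytope:
  assumes k: "0 < k"
  shows "feasible_region k \<subseteq> pre_digraph.flow_polytope (overlap_graph k)"
proof
  interpret fin_digraph "overlap_graph k" by (rule fin_digraph_overlap_graph[OF k])
  fix v assume "v \<in> feasible_region k"
  then obtain \<sigma> :: "nat \<Rightarrow> nat list" where keys: "Poly_Mapping.keys v \<subseteq> perms k"
    and nonneg: "\<And>\<pi>. \<pi> \<in> perms k \<Longrightarrow> 0 \<le> Poly_Mapping.lookup v \<pi>"
    and \<sigma>: "\<And>m. \<sigma> m \<in> perms (length (\<sigma> m))" "filterlim (\<lambda>m. length (\<sigma> m)) at_top sequentially"
    and lim: "\<And>\<pi>. \<pi> \<in> perms k \<Longrightarrow> (\<lambda>m. c_occ_freq \<pi> (\<sigma> m)) \<longlonglongrightarrow> Poly_Mapping.lookup v \<pi>"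
    unfolding feasible_region_def by blast
  \<comment> \<open>Scaled by the size of the permutation, as in \<open>c_occ_freq\<close>, rather
    than by the number of windows.\<close>
  define F where "F m = (1 / real (length (\<sigma> m))) *\<^sub>R arc_vec (pattern_walk k (\<sigma> m))" for m
  have F: "(\<lambda>m. Poly_Mapping.lookup (F m) \<pi>) \<longlonglongrightarrow> Poly_Mapping.lookup v \<pi>" if "\<pi> \<in> perms k" for \<pi>
    using lim[OF that] that by (simp add: F_def c_occ_freq_def count_list_pattern_walk)
  have large: "eventually (\<lambda>m. k \<le> length (\<sigma> m)) sequentially"
    using \<sigma>(2) by (simp add: filterlim_at_top)
  have inv: "(\<lambda>m. 1 / real (length (\<sigma> m))) \<longlonglongrightarrow> 0"
    using filterlim_compose[OF lim_1_over_n \<sigma>(2)] .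
  have walk: "\<exists>a b. awalk a (pattern_walk k (\<sigma> m)) b" if "k \<le> length (\<sigma> m)" for m
    using awalk_pattern_walk[OF k permsD(1)[OF \<sigma>(1)[of m]]] that by fastforce
  have "(\<lambda>m. total (F m)) \<longlonglongrightarrow> total v"
    unfolding total_def by (intro tendsto_sum F) simp
  moreover have "(\<lambda>m. total (F m)) \<longlonglongrightarrow> 1"
  proof (rule Lim_transform_eventually)
    \<comment> \<open>Size \<open>n \<ge> k\<close> gives \<open>n + 1 - k\<close> windows, so the
      total is \<open>1 - (k - 1) / n\<close>.\<close>
    have "(\<lambda>m. 1 - (real k - 1) * (1 / real (length (\<sigma> m)))) \<longlonglongrightarrow> 1 - (real k - 1) * 0"
      by (intro tendsto_intros inv)
    then show "(\<lambda>m. 1 - (real k - 1) * (1 / real (length (\<sigma> m)))) \<longlonglongrightarrow> 1" by simp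
    show "eventually (\<lambda>m. 1 - (real k - 1) * (1 / real (length (\<sigma> m))) = total (F m)) sequentially"
      using large
    proof eventually_elim
      case (elim m)
      then have "set (pattern_walk k (\<sigma> m)) \<subseteq> arcs (overlap_graph k)" using walk by blast
      from total_arc_vec[OF this]
      have "total (F m) = (real (length (\<sigma> m)) + 1 - real k) / real (length (\<sigma> m))"
        using elim by (simp add: F_def of_nat_diff)
      moreover have "\<sigma> m \<noteq> []" using elim k by auto
      ultimately show ?case by (simp add: field_simps)
    qed
  qed
  ultimately have "total v = 1" by (rule LIMSEQ_unique)
  moreover have "netflow v w = 0" if w: "w \<in> perms (k - 1)" for w
  proof (rule LIMSEQ_unique)
    show "(\<lambda>m. netflow (F m) w) \<longlonglongrightarrow> netflow v w"
      unfolding netflow_def by (intro tendsto_diff tendsto_sum F) auto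
    \<comment> \<open>A walk leaves each vertex as often as it enters it, up to 1.\<close>
    show "(\<lambda>m. netflow (F m) w) \<longlonglongrightarrow> 0"
    proof (rule Lim_null_comparison[OF _ inv])
      show "eventually (\<lambda>m. norm (netflow (F m) w) \<le> 1 / real (length (\<sigma> m))) sequentially"
        using large
      proof eventually_elim
        case (elim m)
        then obtain a b where "awalk a (pattern_walk k (\<sigma> m)) b" using walk by blast
        from netflow_arc_vec[OF this] show ?case
          by (simp add: F_def divide_right_mono)
      qed
    qed
  qed
  moreover have "0 \<le> Poly_Mapping.lookup v \<pi>" for \<pi>
    using nonneg keys by (metis in_keys_iff order_refl subsetD)
  ultimately show "v \<in> flow_polytope" using keys by (simp add: flow_polytope_def)
qed

text \<open>Closed walks with the prescribed limiting frequencies are lifted to distinct lists and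
  then standardised, which changes no window pattern.\<close>

lemma flow_polytope_subset_feasible_region:
  assumes k: "0 < k"
  shows "pre_digraph.flow_polytope (overlap_graph k) \<subseteq> feasible_region k"
proof
  interpret fin_digraph "overlap_graph k" by (rule fin_digraph_overlap_graph[OF k])
  fix v assume v: "v \<in> flow_polytope"
  then have keys: "Poly_Mapping.keys v \<subseteq> perms k" and nonneg: "\<And>\<pi>. 0 \<le> Poly_Mapping.lookup v \<pi>"
    and tot: "total v = 1" by (auto simp: flow_polytope_def)
  note sc = strongly_connected_overlap_graph[OF k]
  then obtain r where r: "r \<in> verts (overlap_graph k)" by (auto simp: strongly_connected_def)
  \<comment> \<open>A walk lifts to a list with \<open>k - 1\<close> more entries than it has arcs,
    so this shift makes the denominator the size of the permutation.\<close>
  obtain p where p: "\<And>m. awalk r (p m) r" "filterlim (\<lambda>m. length (p m)) at_top sequentially"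
    "\<And>e. (\<lambda>m. real (count_list (p m) e) / (real (length (p m)) + real (k - 1))) \<longlonglongrightarrow> Poly_Mapping.lookup v e"
    by (rule ex_awalks_tendsto[OF sc r v, of "real (k - 1)"]) blast
  obtain \<tau> where \<tau>: "\<And>m. distinct (\<tau> m)" "\<And>m. length (\<tau> m) = length (p m) + (k - 1)"
    "\<And>m. pattern_walk k (\<tau> m) = p m"
    using awalk_overlap_graph_lift[OF k p(1)] by metis
  have len: "length (std (\<tau> m)) = length (p m) + (k - 1)" for m
    using \<tau>(2) by (simp add: std_def)
  have "\<forall>m. std (\<tau> m) \<in> perms (length (std (\<tau> m)))"
    using std_in_perms[OF \<tau>(1)] len \<tau>(2) by simp
  moreover have "filterlim (\<lambda>m. length (std (\<tau> m))) at_top sequentially"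
    by (rule filterlim_at_top_mono[OF p(2)]) (simp add: len)
  moreover have "(\<lambda>m. c_occ_freq \<pi> (std (\<tau> m))) \<longlonglongrightarrow> Poly_Mapping.lookup v \<pi>" if "\<pi> \<in> perms k" for \<pi>
  proof -
    have "c_occ \<pi> (std (\<tau> m)) = count_list (p m) \<pi>" for m
      using count_list_pattern_walk[OF that, of "std (\<tau> m)"] pattern_walk_std[OF \<tau>(1)] \<tau>(3) by simp
    then show ?thesis using p(3)[of \<pi>] by (simp add: c_occ_freq_def len)
  qed
  moreover have "Poly_Mapping.lookup v \<pi> \<le> 1" if "\<pi> \<in> perms k" for \<pi>
    using member_le_sum[of \<pi> "perms k" "Poly_Mapping.lookup v"] that nonneg tot finite_perms
    by (simp add: total_def)
  ultimately show "v \<in> feasible_region k"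
    unfolding feasible_region_def mem_Collect_eq
    using keys nonneg by (intro conjI exI[of _ "\<lambda>m. std (\<tau> m)"]) auto
qed

text \<open>All three claims are facts about the flow polytope; the dimension is the number
  \<open>fact k\<close> of arcs minus the number \<open>fact (k - 1)\<close> of vertices.\<close>

theorem theorem2p1:
  fixes k :: nat
  assumes "0 < k"
  shows "feasible_region k = cycle_polytope (overlap_graph k) \<and>
         int (affine_dimension (feasible_region k)) = fact k - fact (k - 1) \<and>
         {v. v extreme_point_of feasible_region k} =
           {cycle_vec C | C. pre_digraph.cycle (overlap_graph k) C}"
proof -
  interpret fin_digraph "overlap_graph k" by (rule fin_digraph_overlap_graph[OF assms])
  have region: "feasible_region k = flow_polytope"
    using feasible_region_subset_flow_polytope flow_polytope_subset_feasible_region assms by blast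
  have "arcs (overlap_graph k) \<noteq> {}"
    using card_perms[of k] by (metis card.empty fact_nonzero overlap_graph_simps(2))
  from affine_dimension_flow_polytope[OF strongly_connected_overlap_graph[OF assms] this]
  have "affine_dimension flow_polytope + fact (k - 1) = (fact k :: nat)"
    by (simp add: card_perms)
  \<comment> \<open>Passing to integers before subtracting avoids truncation.\<close>
  then have "int (affine_dimension flow_polytope) + int (fact (k - 1)) = int (fact k)"
    by (metis of_nat_add)
  then have "int (affine_dimension flow_polytope) = fact k - fact (k - 1)"
    by simp
  then show ?thesis
    unfolding region using flow_polytope_eq_cycle_polytope extreme_point_flow_polytope by blast
qed

end
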